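(* Let $\mathcal{R}$ be a totally matching partial applicative structure such that there exists $r\in\mathcal{R}$ with $|\mathcal{R}^{\mathsf{Im}(r)}|>|\mathcal{R}|$. Then $(\mathcal{P}(\mathcal{R})^{\mathcal{R}},\vdash_{\mathcal{R}})$ is not complete.
   Context: A partial applicative structure is a non-empty set $\mathcal{R}$ together with a partial binary function $\cdot:\mathcal{R}\times\mathcal{R}\rightharpoonup\mathcal{R}$; $t\downarrow$ means that $t$ is defined. It is totally matching if for every $x,y\in\mathcal{R}$ there exists $r\in\mathcal{R}$ such that $r\cdot x\downarrow$ and $r\cdot x=y$. For $r\in\mathcal{R}$, $\mathsf{Im}(r):=\{r\cdot x\mid x\in\mathcal{R},\ r\cdot x\downarrow\}$. For sets $X,Y$, $Y^X$ is the set of functions from $X$ to $Y$. For $A,B\subseteq\mathcal{R}$ let $A\Rightarrow B:=\{r\in\mathcal{R}\mid \text{for every } a\in A,\ r\cdot a\downarrow \text{ and } r\cdot a\in B\}$. For $\varphi,\psi:\mathcal{R}\to\mathcal{P}(\mathcal{R})$, $\varphi\vdash_{\mathcal{R}}\psi$ means that $\bigcap_{x\in\mathcal{R}}(\varphi(x)\Rightarrow\psi(x))\neq\emptyset$. Given a binary relation $R$ on a set $A$ (not assumed to be a preorder) and a set-indexed family $(a_i)_{i\in I}$ of elements of $A$, an element $b\in A$ is a supremum for $(a_i)_{i\in I}$ if (a) $R(a_i,b)$ for every $i\in I$, and (b) whenever $c\in A$ satisfies $R(a_i,c)$ for every $i\in I$, then $R(b,c)$. The relation $R$ (or the pair $(A,R)$)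 is complete if every set-indexed family of elements of $A$ has a supremum. *)

theory Defs
  imports Main "HOL-Library.Equipollence" "HOL-Library.FuncSet"
begin

text \<open>
  The underlying set of a partial applicative structure is the type \<^typ>\<open>'r\<close> (non-empty, as every
  type is), and the partial application is a function into \<^typ>\<open>'r option\<close>, where
  \<^term>\<open>None\<close> stands for an undefined value.
\<close>

type_synonym 'r pas = "'r \<Rightarrow> 'r \<Rightarrow> 'r option"

definition totally_matching :: "'r pas \<Rightarrow> bool" where
  "totally_matching app \<longleftrightarrow> (\<forall>x y. \<exists>r. app r x = Some y)"

definition pas_image :: "'r pas \<Rightarrow> 'r \<Rightarrow> 'r set" where
  "pas_image app r = {y. \<exists>x. app r x = Some y}"

definition arrow :: "'r pas \<Rightarrow> 'r set \<Rightarrow> 'r set \<Rightarrow> 'r set" where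
  "arrow app A B = {r. \<forall>a\<in>A. \<exists>b. app r a = Some b \<and> b \<in> B}"

definition entails :: "'r pas \<Rightarrow> ('r \<Rightarrow> 'r set) \<Rightarrow> ('r \<Rightarrow> 'r set) \<Rightarrow> bool" where
  "entails app \<phi> \<psi> \<longleftrightarrow> (\<Inter>x. arrow app (\<phi> x) (\<psi> x)) \<noteq> {}"

definition is_supremum ::
  "'a set \<Rightarrow> ('a \<Rightarrow> 'a \<Rightarrow> bool) \<Rightarrow> 'i set \<Rightarrow> ('i \<Rightarrow> 'a) \<Rightarrow> 'a \<Rightarrow> bool" where
  "is_supremum A R I a b \<longleftrightarrow>
     b \<in> A \<and> (\<forall>i\<in>I. R (a i) b) \<and> (\<forall>c\<in>A. (\<forall>i\<in>I. R (a i) c) \<longrightarrow> R b c)"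

text \<open>
  HOL cannot quantify over all index types inside a definition, so the index sets below range over
  the subsets of the type of the elements of \<open>A\<close>. The lemma \<open>complete_rel_family\<close> shows
  that this covers families indexed by sets of an arbitrary type.
\<close>

definition complete_rel :: "'a set \<Rightarrow> ('a \<Rightarrow> 'a \<Rightarrow> bool) \<Rightarrow> bool" where
  "complete_rel A R \<longleftrightarrow>
     (\<forall>(I :: 'a set) (a :: 'a \<Rightarrow> 'a). a \<in> I \<rightarrow> A \<longrightarrow> (\<exists>b. is_supremum A R I a b))"

lemma complete_rel_family:
  fixes I :: "'i set" and a :: "'i \<Rightarrow> 'a"
  assumes "complete_rel A R" and "a \<in> I \<rightarrow> A"
  shows "\<exists>b. is_supremum A R I a b"
proof -
  have "(\<lambda>x. x) \<in> a ` I \<rightarrow> A"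
    using assms(2) by auto
  then obtain b where "is_supremum A R (a ` I) (\<lambda>x. x) b"
    using assms(1) unfolding complete_rel_def by blast
  then have "is_supremum A R I a b"
    unfolding is_supremum_def by auto
  then show ?thesis ..
qed

end

theory Submission
  imports Defs
begin

text \<open>
  For a set \<open>D\<close>, consider for each \<open>i \<in> D\<close> the predicate supported at \<open>i\<close> with value \<open>{i}\<close>.
  By total matching it entails \<open>c\<close> exactly when \<open>c i\<close> is inhabited. A supremum \<open>b\<close> of these
  predicates therefore comes with elements \<open>\<beta> i \<in> b i\<close>, and it entails every predicate that has
  singleton values \<open>{f i}\<close> on \<open>D\<close>. A realizer of this entailment sends each \<open>\<beta> i\<close> to \<open>f i\<close>, so
  it determines \<open>f\<close>, and there are at most as many functions \<open>f\<close> on \<open>D\<close> as realizers.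
\<close>

text \<open>For \<open>x \<noteq> i\<close> the antecedent is empty, so every element realizes the
  implication; only the value at \<open>i\<close> constrains a realizer.\<close>

lemma entails_point_iff:
  assumes "totally_matching app"
  shows "entails app (\<lambda>x. if x = i then {i} else {}) c \<longleftrightarrow> c i \<noteq> {}"
proof
  assume "entails app (\<lambda>x. if x = i then {i} else {}) c"
  then show "c i \<noteq> {}"
    unfolding entails_def arrow_def by (auto split: if_splits)
next
  assume "c i \<noteq> {}"
  then obtain y where "y \<in> c i" by blast
  moreover obtain r where "app r i = Some y"
    using assms unfolding totally_matching_def by blast
  ultimately have "r \<in> (\<Inter>x. arrow app (if x = i then {i} else {}) (c x))"
    unfolding arrow_def by auto
  then show "entails app (\<lambda>x. if x = i then {i} else {}) c"
    unfolding entails_def by blast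
qed

lemma complete_imp_funcset_lepoll:
  fixes app :: "'r pas" and D :: "'r set"
  assumes tm: "totally_matching app"
    and complete: "complete_rel (UNIV :: ('r \<Rightarrow> 'r set) set) (entails app)"
  shows "(D \<rightarrow>\<^sub>E (UNIV :: 'r set)) \<lesssim> (UNIV :: 'r set)"
proof -
  have "(\<lambda>i x. if x = i then {i} else {}) \<in> D \<rightarrow> (UNIV :: ('r \<Rightarrow> 'r set) set)"
    by simp
  from complete_rel_family[OF complete this] obtain b
    where b: "is_supremum UNIV (entails app) D (\<lambda>i x. if x = i then {i} else {}) b" ..
  have "\<forall>i\<in>D. \<exists>y. y \<in> b i"
    using b by (auto simp: is_supremum_def entails_point_iff[OF tm])
  then obtain \<beta> where \<beta>: "\<And>i. i \<in> D \<Longrightarrow> \<beta> i \<in> b i"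
    by metis
  have "f \<in> range (\<lambda>r. \<lambda>i\<in>D. the (app r (\<beta> i)))" if f: "f \<in> D \<rightarrow>\<^sub>E UNIV" for f
  proof -
    \<comment> \<open>Each \<open>{f i}\<close> is inhabited, so this predicate is an upper bound of
      the family.\<close>
    have "entails app b (\<lambda>i. {f i})"
      using b unfolding is_supremum_def entails_point_iff[OF tm] by simp
    then obtain r where r: "\<And>i. r \<in> arrow app (b i) {f i}"
      unfolding entails_def by blast
    have "app r (\<beta> i) = Some (f i)" if "i \<in> D" for i
      using r[of i] \<beta>[OF that] unfolding arrow_def by auto
    \<comment> \<open>Off \<open>D\<close> both sides are \<open>undefined\<close>.\<close>
    then have "f = (\<lambda>i\<in>D. the (app r (\<beta> i)))"
      using PiE_arb[OF f] by (simp add: fun_eq_iff)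
    then show ?thesis by blast
  qed
  then show ?thesis
    unfolding lepoll_iff by blast
qed

theorem theorem3p17:
  fixes app :: "'r pas"
  assumes "totally_matching app"
    and "\<exists>r. (UNIV :: 'r set) \<prec> (pas_image app r \<rightarrow>\<^sub>E (UNIV :: 'r set))"
  shows "\<not> complete_rel (UNIV :: ('r \<Rightarrow> 'r set) set) (entails app)"
proof
  assume "complete_rel (UNIV :: ('r \<Rightarrow> 'r set) set) (entails app)"
  then have "(D \<rightarrow>\<^sub>E (UNIV :: 'r set)) \<lesssim> (UNIV :: 'r set)" for D :: "'r set"
    using complete_imp_funcset_lepoll[OF assms(1)] by simp
  then show False
    \<comment> \<open>For \<open>D = pas_image app r\<close>, antisymmetry gives an equipollence,
      which \<open>\<prec>\<close> excludes.\<close>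
    using assms(2) lepoll_antisym unfolding lesspoll_def by metis
qed

end
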